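(* Let $F$ be a field. Every nilpotent symplectic alternating algebra $L$ over $F$ of dimension $2n$ has a nilpotent presentation; that is, there are a standard basis $x_{1},y_{1},\ldots,x_{n},y_{n}$ of $L$ and scalars $\alpha(i,j,k),\beta(i,j,k)\in F$ for $1\leq i<j<k\leq n$ such that $L$ is given with respect to this basis by the nilpotent presentation $$\mathcal{P}:\ \ (x_{i}y_{j},y_{k})=\alpha(i,j,k),\quad (y_{i}y_{j},y_{k})=\beta(i,j,k),\qquad 1\leq i<j<k\leq n.$$ Conversely, for every choice of scalars $\alpha(i,j,k),\beta(i,j,k)\in F$, $1\leq i<j<k\leq n$, the symplectic alternating algebra described by the nilpotent presentation $\mathcal{P}$ is nilpotent.
   Context: A symplectic alternating algebra over a field $F$ is a triple $(L,(\ ,\ ),\cdot)$ where $L$ is a finite-dimensional vector space over $F$ with a non-degenerate alternating bilinear form $(\ ,\ )$ and $\cdot$ is a bilinear alternating operation on $L$ (so $u\cdot u=0$ for all $u$) such that $(u\cdot v,w)=(v\cdot w,u)$ for all $u,v,w\in L$. Then $\dim L=2n$ is even. The map $(u,v,w)\mapsto (u\cdot v,w)$ is an alternating ternary form, and each alternating ternary form on a given symplectic vector space arises from a unique symplectic alternating algebra structure. An ideal is a subspace $I$ with $IL\leq I$, where $UV$ denotes the subspace spanned by all products $u\cdot v$ with $u\in U$, $v\in V$. $L$ is nilpotent if there is a chain of ideals $\{0\}=I_{0}\leq I_{1}\leq\cdots\leq I_{m}=L$ with $I_{s}L\leq I_{s-1}$ for $s=1,\ldots,m$. A standard basis of $L$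 is a basis $x_{1},y_{1},\ldots,x_{n},y_{n}$ with $(x_{i},x_{j})=(y_{i},y_{j})=0$ and $(x_{i},y_{j})=\delta_{ij}$ for all $i,j$. The data $\mathcal{P}$, called a nilpotent presentation, describes the symplectic alternating algebra with standard basis $x_{1},y_{1},\ldots,x_{n},y_{n}$ for which the alternating ternary form $(u\cdot v,w)$ takes the listed values on the listed triples of basis elements, and vanishes on every triple of basis elements that is not, up to permutation, one of the triples $(x_{i},y_{j},y_{k})$ or $(y_{i},y_{j},y_{k})$ with $1\leq i<j<k\leq n$. *)

theory Defs
  imports Complex_Main
begin

text \<open>The vector space is the whole type \<^typ>\<open>'v\<close>, with scalar multiplication \<open>scale\<close> over the
  field \<^typ>\<open>'a\<close>.\<close>

locale symplectic_space = vector_space scale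
  for scale :: "'a::field \<Rightarrow> 'v::ab_group_add \<Rightarrow> 'v" +
  fixes form :: "'v \<Rightarrow> 'v \<Rightarrow> 'a"
  assumes finite_dimensional: "\<exists>Basis. finite_dimensional_vector_space scale Basis"
    and form_linear_left: "Vector_Spaces.linear scale (*) (\<lambda>u. form u v)"
    and form_linear_right: "Vector_Spaces.linear scale (*) (\<lambda>v. form u v)"
    and form_alternating: "form u u = 0"
    and form_nondegenerate: "(\<And>v. form u v = 0) \<Longrightarrow> u = 0"
begin

text \<open>Families indexed by \<open>1, \<dots>, n\<close> are functions on \<^typ>\<open>nat\<close>, whose values outside
  \<open>{1..n}\<close> are irrelevant.\<close>

definition standard_basis :: "nat \<Rightarrow> (nat \<Rightarrow> 'v) \<Rightarrow> (nat \<Rightarrow> 'v) \<Rightarrow> bool" where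
  "standard_basis n x y \<longleftrightarrow>
     card (x ` {1..n} \<union> y ` {1..n}) = 2 * n \<and>
     independent (x ` {1..n} \<union> y ` {1..n}) \<and>
     span (x ` {1..n} \<union> y ` {1..n}) = UNIV \<and>
     (\<forall>i\<in>{1..n}. \<forall>j\<in>{1..n}.
        form (x i) (x j) = 0 \<and> form (y i) (y j) = 0 \<and>
        form (x i) (y j) = (if i = j then 1 else 0))"

end

locale symplectic_alternating_algebra = symplectic_space scale form
  for scale :: "'a::field \<Rightarrow> 'v::ab_group_add \<Rightarrow> 'v" and form :: "'v \<Rightarrow> 'v \<Rightarrow> 'a" +
  fixes mult :: "'v \<Rightarrow> 'v \<Rightarrow> 'v"  (infixl "\<cdot>" 70)
  assumes mult_linear_left: "Vector_Spaces.linear scale scale (\<lambda>u. u \<cdot> v)"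
    and mult_linear_right: "Vector_Spaces.linear scale scale (\<lambda>v. u \<cdot> v)"
    and mult_alternating: "u \<cdot> u = 0"
    and form_mult_cyclic: "form (u \<cdot> v) w = form (v \<cdot> w) u"
begin

definition subspace_prod :: "'v set \<Rightarrow> 'v set \<Rightarrow> 'v set" where
  "subspace_prod U V = span {u \<cdot> v |u v. u \<in> U \<and> v \<in> V}"

definition ideal :: "'v set \<Rightarrow> bool" where
  "ideal I \<longleftrightarrow> subspace I \<and> subspace_prod I UNIV \<subseteq> I"

definition nilpotent :: bool where
  "nilpotent \<longleftrightarrow> (\<exists>(m::nat) I.
     I 0 = {0} \<and> I m = UNIV \<and>
     (\<forall>s\<le>m. ideal (I s)) \<and>
     (\<forall>s\<in>{1..m}. I (s - 1) \<subseteq> I s \<and> subspace_prod (I s) UNIV \<subseteq> I (s - 1)))"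

text \<open>The elements of a standard basis are distinct, so for basis elements equality of
  the sets \<open>{a, b, c}\<close> and \<open>{x i, y j, y k}\<close> (or \<open>{y i, y j, y k}\<close>) says that the triples
  agree up to permutation. The values of \<open>\<alpha>\<close> and \<open>\<beta>\<close> matter only
  at \<open>1 \<le> i < j < k \<le> n\<close>.\<close>

definition nilpotent_presentation ::
    "nat \<Rightarrow> (nat \<Rightarrow> 'v) \<Rightarrow> (nat \<Rightarrow> 'v) \<Rightarrow>
      (nat \<Rightarrow> nat \<Rightarrow> nat \<Rightarrow> 'a) \<Rightarrow> (nat \<Rightarrow> nat \<Rightarrow> nat \<Rightarrow> 'a) \<Rightarrow> bool" where
  "nilpotent_presentation n x y \<alpha> \<beta> \<longleftrightarrow>
     standard_basis n x y \<and>
     (\<forall>i j k. 1 \<le> i \<and> i < j \<and> j < k \<and> k \<le> n \<longrightarrow>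
        form (x i \<cdot> y j) (y k) = \<alpha> i j k \<and> form (y i \<cdot> y j) (y k) = \<beta> i j k) \<and>
     (\<forall>a \<in> x ` {1..n} \<union> y ` {1..n}. \<forall>b \<in> x ` {1..n} \<union> y ` {1..n}. \<forall>c \<in> x ` {1..n} \<union> y ` {1..n}.
        (\<nexists>i j k. 1 \<le> i \<and> i < j \<and> j < k \<and> k \<le> n \<and>
           ({a, b, c} = {x i, y j, y k} \<or> {a, b, c} = {y i, y j, y k})) \<longrightarrow>
        form (a \<cdot> b) c = 0)"

end

end

theory Submission
  imports Defs
begin

text \<open>Given an isotropic ideal \<open>J\<close> of dimension less than \<open>n\<close>, the ideal \<open>J\<^sup>\<bottom>\<close> is not contained in \<open>J\<close>,
  so nilpotency yields \<open>v \<in> J\<^sup>\<bottom>\<close> outside \<open>J\<close> with \<open>v L \<subseteq> J\<close>, and \<open>J + F v\<close> is again an isotropic ideal.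
  Iterating gives a Lagrangian ideal with basis \<open>x\<^sub>n, \<dots>, x\<^sub>1\<close> such that \<open>x\<^sub>i L\<close> lies in the span of the
  \<open>x\<^sub>k\<close> with \<open>k > i\<close>. Any completion of it to a standard basis gives a nilpotent presentation:
  \<open>(x\<^sub>i y\<^sub>j, y\<^sub>k) \<noteq> 0\<close> forces \<open>i < k\<close>, hence by symmetry \<open>i < j\<close>.
  Conversely, under a nilpotent presentation the spans of the initial segments of
  \<open>x\<^sub>n, \<dots>, x\<^sub>1, y\<^sub>1, \<dots>, y\<^sub>n\<close> form a central series.\<close>

section \<open>Bilinear calculus and duality for a non-degenerate alternating form\<close>

context symplectic_space
begin

lemma form_add_left: "form (u + u') v = form u v + form u' v"
  using form_linear_left[of v] by (simp add: Vector_Spaces.linear_iff)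

lemma form_scale_left: "form (scale c u) v = c * form u v"
  using form_linear_left[of v] by (simp add: Vector_Spaces.linear_iff)

lemma form_add_right: "form u (v + v') = form u v + form u v'"
  using form_linear_right[of u] by (simp add: Vector_Spaces.linear_iff)

lemma form_scale_right: "form u (scale c v) = c * form u v"
  using form_linear_right[of u] by (simp add: Vector_Spaces.linear_iff)

lemma form_zero_left: "form 0 v = 0"
  using form_scale_left[of 0 0 v] by simp

lemma form_zero_right: "form u 0 = 0"
  using form_scale_right[of u 0 0] by simp

lemma form_diff_left: "form (u - u') v = form u v - form u' v"
  using form_add_left[of "u - u'" u' v] by simp

lemma form_diff_right: "form u (v - v') = form u v - form u v'"
  using form_add_right[of u "v - v'" v'] by simp

lemma form_sum_left: "form (\<Sum>i\<in>S. f i) v = (\<Sum>i\<in>S. form (f i) v)"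
  by (induction S rule: infinite_finite_induct) (simp_all add: form_zero_left form_add_left)

lemma form_sum_right: "form u (\<Sum>i\<in>S. f i) = (\<Sum>i\<in>S. form u (f i))"
  by (induction S rule: infinite_finite_induct) (simp_all add: form_zero_right form_add_right)

lemmas form_simps = form_add_left form_add_right form_scale_left form_scale_right form_zero_left
  form_zero_right form_diff_left form_diff_right form_sum_left form_sum_right

lemma form_swap: "form v u = - form u v"
proof -
  have "form (u + v) (u + v) = form u v + form v u"
    by (subst form_add_left) (simp add: form_add_right form_alternating)
  then have "form u v + form v u = 0" by (simp only: form_alternating)
  then show ?thesis by (simp add: eq_neg_iff_add_eq_0 add.commute)
qed

lemma form_eq_0_swap: "form v u = 0 \<longleftrightarrow> form u v = 0"
  using form_swap[of u v] by simp

lemma form_0_span_right: "form u v = 0" if "v \<in> span S" "\<And>s. s \<in> S \<Longrightarrow> form u s = 0"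
  using that(1) by (induction rule: span_induct_alt) (auto simp: form_simps that(2))

lemma form_0_span_left: "form u v = 0" if "u \<in> span S" "\<And>s. s \<in> S \<Longrightarrow> form s v = 0"
  using form_0_span_right[of u S v] that by (simp add: form_eq_0_swap)

text \<open>Non-degeneracy applied to \<open>u - v\<close>. Identities between vectors are proved
  below by comparing their pairings with a spanning set.\<close>

lemma form_left_cancel:
  assumes "span S = UNIV" "\<And>s. s \<in> S \<Longrightarrow> form u s = form v s"
  shows "u = v"
proof -
  have "form (u - v) w = 0" for w
    using form_0_span_right[of w S "u - v"] assms by (simp add: form_simps)
  then show ?thesis using form_nondegenerate[of "u - v"] by simp
qed

text \<open>This is half of the double-orthogonal theorem, namely that
  (\<open>S\<close>\<bottom>)\<bottom> lies in \<open>span S\<close>. Adjoining vectors to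
  \<open>S\<close> one at a time replaces any count of dimensions.\<close>

lemma separating_vector:
  assumes "finite S" "w \<notin> span S"
  obtains u where "\<And>s. s \<in> S \<Longrightarrow> form s u = 0" "form w u = 1"
proof -
  have "\<exists>u. (\<forall>s\<in>S. form s u = 0) \<and> form w u = 1"
    using assms
  proof (induction S arbitrary: w rule: finite_induct)
    case empty
    then obtain u where "form w u \<noteq> 0" using form_nondegenerate[of w] by auto
    then have "form w (scale (1 / form w u) u) = 1" by (simp add: form_simps)
    then show ?case by blast
  next
    case (insert s S)
    show ?case
    proof (cases "s \<in> span S")
      case True
      have "w \<notin> span S" using insert.prems span_mono[of S "insert s S"] by blast
      then obtain u where u: "\<forall>s\<in>S. form s u = 0" "form w u = 1" using insert.IH by blast
      then have "form s u = 0" using form_0_span_left[OF True] by blast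
      then show ?thesis using u by blast
    next
      case False
      then obtain t where t: "\<forall>s\<in>S. form s t = 0" "form s t = 1" using insert.IH by blast
      \<comment> \<open>Subtracting (s,u)t from a solution \<open>u\<close> for \<open>S\<close>
        makes it orthogonal to \<open>s\<close> and changes (w,u) into (w - (w,t)s, u). So the
        induction hypothesis is used for w - (w,t)s instead of \<open>w\<close>.\<close>
      have "w - scale (form w t) s \<notin> span S"
        using insert.prems by (auto simp: span_breakdown_eq)
      then obtain u where u: "\<forall>s\<in>S. form s u = 0" "form (w - scale (form w t) s) u = 1"
        using insert.IH by blast
      have "\<forall>r\<in>insert s S. form r (u - scale (form s u) t) = 0"
        using t u by (simp add: form_simps)
      moreover have "form w (u - scale (form s u) t) = 1"
        using u(2) by (simp add: form_simps algebra_simps)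
      ultimately show ?thesis by blast
    qed
  qed
  then show ?thesis using that by blast
qed

lemma dual_family:
  fixes z :: "'i \<Rightarrow> 'v"
  assumes "finite K" "inj_on z K" "independent (z ` K)"
  obtains u where "\<And>i j. i \<in> K \<Longrightarrow> j \<in> K \<Longrightarrow> form (z i) (u j) = (if i = j then 1 else 0)"
proof -
  have "\<exists>u. \<forall>i\<in>K. form (z i) u = (if i = j then 1 else 0)" if "j \<in> K" for j
  proof -
    have "z j \<notin> span (z ` K - {z j})" using assms(3) that by (auto simp: dependent_def)
    moreover have "finite (z ` K - {z j})" using assms(1) by simp
    ultimately obtain u where "\<And>s. s \<in> z ` K - {z j} \<Longrightarrow> form s u = 0" "form (z j) u = 1"
      using separating_vector by blast
    then have "\<forall>i\<in>K. form (z i) u = (if i = j then 1 else 0)"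
      using assms(2) that by (auto simp: inj_on_def)
    then show ?thesis by blast
  qed
  then obtain u where "\<forall>j\<in>K. \<forall>i\<in>K. form (z i) (u j) = (if i = j then 1 else 0)" by metis
  then show ?thesis using that by blast
qed

text \<open>Subtracting from \<open>v\<close> the combination of the dual vectors with the same
  pairings against \<open>z\<close> leaves a vector of the orthogonal complement. If that complement
  lies in the span of \<open>z\<close>, then \<open>z\<close> and its dual family span everything.
  The contrapositive is what makes a short isotropic family extendable.\<close>

lemma dim_le_if_perp_subset:
  assumes "finite K" "inj_on z K" "independent (z ` K)"
    and perp: "{v. \<forall>s\<in>z ` K. form s v = 0} \<subseteq> span (z ` K)"
  shows "dim (UNIV :: 'v set) \<le> 2 * card K"
proof -
  obtain u where u: "\<And>i j. i \<in> K \<Longrightarrow> j \<in> K \<Longrightarrow> form (z i) (u j) = (if i = j then 1 else 0)"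
    using dual_family assms(1-3) by blast
  have "v \<in> span (z ` K \<union> u ` K)" for v
  proof -
    let ?p = "\<Sum>j\<in>K. scale (form (z j) v) (u j)"
    have "form (z i) (v - ?p) = 0" if "i \<in> K" for i
      using that assms(1) by (simp add: form_simps u if_distrib cong: if_cong)
    then have "v - ?p \<in> span (z ` K \<union> u ` K)"
      using perp span_mono[of "z ` K" "z ` K \<union> u ` K"] by blast
    moreover have "?p \<in> span (z ` K \<union> u ` K)"
      by (intro span_sum span_scale span_base) auto
    ultimately have "v - ?p + ?p \<in> span (z ` K \<union> u ` K)" by (rule span_add)
    then show ?thesis by simp
  qed
  then have "dim (UNIV :: 'v set) \<le> card (z ` K \<union> u ` K)"
    using assms(1) by (intro dim_le_card) auto
  also have "\<dots> \<le> card (z ` K) + card (u ` K)" by (rule card_Un_le)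
  also have "\<dots> \<le> card K + card K" by (intro add_mono card_image_le assms(1))
  finally show ?thesis by simp
qed

section \<open>Standard bases: recognition, completion and coordinates\<close>

lemma independent_if_dual:
  assumes "\<And>b. b \<in> B \<Longrightarrow> \<exists>d. form b d \<noteq> 0 \<and> (\<forall>c\<in>B - {b}. form c d = 0)"
  shows "independent B"
  using assms form_0_span_left unfolding dependent_def by metis

text \<open>The pairings alone force the 2n vectors to be distinct and independent, since
  \<open>x i\<close> and \<open>y i\<close> detect each other and are orthogonal to the rest;
  spanning then follows from the dimension.\<close>

lemma standard_basisI:
  assumes dim: "dim (UNIV :: 'v set) = 2 * n"
    and iso: "\<And>i j. i \<in> {1..n} \<Longrightarrow> j \<in> {1..n} \<Longrightarrow> form (x i) (x j) = 0 \<and> form (y i) (y j) = 0 \<and>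
        form (x i) (y j) = (if i = j then 1 else 0)"
  shows "standard_basis n x y"
proof -
  let ?B = "x ` {1..n} \<union> y ` {1..n}"
  have yx: "form (y i) (x j) = (if i = j then - 1 else 0)" if "i \<in> {1..n}" "j \<in> {1..n}" for i j
    using iso[OF that(2,1)] form_swap[of "y i" "x j"] by auto
  have "inj_on x {1..n}" "inj_on y {1..n}"
    by (rule inj_onI; metis iso zero_neq_one)+
  moreover have "x ` {1..n} \<inter> y ` {1..n} = {}"
    using iso by (auto simp: set_eq_iff) (metis One_nat_def iso atLeastAtMost_iff zero_neq_one)
  ultimately have card: "card ?B = 2 * n"
    by (simp add: card_Un_disjoint card_image)
  have indep: "independent ?B"
  proof (rule independent_if_dual)
    fix b assume "b \<in> ?B"
    then consider i where "i \<in> {1..n}" "b = x i" | i where "i \<in> {1..n}" "b = y i" by blast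
    then show "\<exists>d. form b d \<noteq> 0 \<and> (\<forall>c\<in>?B - {b}. form c d = 0)"
    proof cases
      case 1
      then show ?thesis using iso by (intro exI[of _ "y i"]) (auto split: if_splits)
    next
      case 2
      then show ?thesis using iso yx by (intro exI[of _ "x i"]) (auto split: if_splits)
    qed
  qed
  obtain Basis where "finite_dimensional_vector_space scale Basis" using finite_dimensional by blast
  then interpret finite_dimensional_vector_space scale Basis .
  have "span ?B = UNIV"
    using card_ge_dim_independent[of ?B UNIV] card dim indep by auto
  then show ?thesis using card indep iso by (auto simp: standard_basis_def)
qed

text \<open>Adding combinations of the mutually orthogonal \<open>x\<close> to a dual family
  \<open>u\<close> keeps the pairings with \<open>x\<close>. This freedom is enough to make the
  corrected family isotropic.\<close>

lemma standard_basis_extension: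
  assumes dim: "dim (UNIV :: 'v set) = 2 * n"
    and inj: "inj_on x {1..n}" and indep: "independent (x ` {1..n})"
    and iso: "\<And>i j. i \<in> {1..n} \<Longrightarrow> j \<in> {1..n} \<Longrightarrow> form (x i) (x j) = 0"
  obtains y where "standard_basis n x y"
proof -
  obtain u where u: "\<And>i j. i \<in> {1..n} \<Longrightarrow> j \<in> {1..n} \<Longrightarrow> form (x i) (u j) = (if i = j then 1 else 0)"
    using dual_family[OF finite_atLeastAtMost inj indep] by blast
  \<comment> \<open>strictly triangular \<open>c\<close> with \<open>c i j - c j i = form (u i) (u j)\<close>; this works in characteristic 2 too\<close>
  define c where "c i j = (if i < j then form (u i) (u j) else 0)" for i j
  define y where "y j = u j + (\<Sum>m\<in>{1..n}. scale (c m j) (x m))" for j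
  have ux: "form (u i) (x j) = (if i = j then - 1 else 0)" if "i \<in> {1..n}" "j \<in> {1..n}" for i j
    using u[OF that(2,1)] form_swap[of "u i" "x j"] by auto
  have "form (x i) (y j) = (if i = j then 1 else 0)" if "i \<in> {1..n}" "j \<in> {1..n}" for i j
    using that by (simp add: y_def form_simps u iso)
  moreover have "form (y i) (y j) = 0" if "i \<in> {1..n}" "j \<in> {1..n}" for i j
  proof -
    have "form (y i) (y j) = form (u i) (u j) - c i j + c j i"
      using that by (simp add: y_def form_simps u ux iso if_distrib[of "(*) _"] cong: if_cong)
    then show ?thesis
      using form_swap[of "u i" "u j"] by (cases i j rule: linorder_cases)
        (auto simp: c_def form_alternating)
  qed
  ultimately show ?thesis using standard_basisI[OF dim, of x y] iso that by blast
qed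

lemma standard_basis_form:
  assumes "standard_basis n x y" "i \<in> {1..n}" "j \<in> {1..n}"
  shows "form (x i) (x j) = 0" "form (y i) (y j) = 0"
    and "form (x i) (y j) = (if i = j then 1 else 0)"
    and "form (y i) (x j) = (if i = j then - 1 else 0)"
  using assms form_swap[of "y i" "x j"] by (auto simp: standard_basis_def)

lemma standard_basis_distinct:
  assumes "standard_basis n x y" "i \<in> {1..n}" "j \<in> {1..n}"
  shows "x i = x j \<longleftrightarrow> i = j" "y i = y j \<longleftrightarrow> i = j" "x i \<noteq> y j" "y j \<noteq> x i"
proof -
  show "x i = x j \<longleftrightarrow> i = j"
    using standard_basis_form(3)[OF assms(1,2,2)] standard_basis_form(3)[OF assms(1,3,2)]
    by (auto split: if_splits)
  show "y i = y j \<longleftrightarrow> i = j"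
    using standard_basis_form(3)[OF assms(1,2,2)] standard_basis_form(3)[OF assms(1,2,3)]
    by (auto split: if_splits)
  show "x i \<noteq> y j"
    using standard_basis_form(3)[OF assms(1,2,2)] standard_basis_form(2)[OF assms(1,3,2)] by auto
  then show "y j \<noteq> x i" by simp
qed

lemma standard_basis_expansion:
  assumes B: "standard_basis n x y"
  shows "v = (\<Sum>i\<in>{1..n}. scale (form v (y i)) (x i)) + (\<Sum>i\<in>{1..n}. scale (form (x i) v) (y i))"
    (is "v = ?w")
proof (rule form_left_cancel)
  show "span (x ` {1..n} \<union> y ` {1..n}) = UNIV" using B by (simp add: standard_basis_def)
  fix s assume "s \<in> x ` {1..n} \<union> y ` {1..n}"
  then consider j where "j \<in> {1..n}" "s = x j" | j where "j \<in> {1..n}" "s = y j" by blast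
  then show "form v s = form ?w s"
  proof cases
    case 1
    then show ?thesis
      using form_swap[of v "x j"]
      by (simp add: form_simps standard_basis_form[OF B] if_distrib[of "(*) _"] cong: if_cong)
  next
    case 2
    then show ?thesis
      by (simp add: form_simps standard_basis_form[OF B] if_distrib[of "(*) _"] cong: if_cong)
  qed
qed

text \<open>By non-degeneracy the functional \<open>T u v\<close> is represented by a unique vector,
  which is taken as the product of \<open>u\<close> and \<open>v\<close>. The algebra laws are then
  the corresponding properties of \<open>T\<close>.\<close>

lemma algebra_of_trilinear_form:
  assumes B: "standard_basis n x y"
    and T_add: "\<And>u v w w'. T u v (w + w') = T u v w + T u v w'"
    and T_scale: "\<And>u v c w. T u v (scale c w) = c * T u v w"
    and T_alternating: "\<And>u w. T u u w = 0"
    and T_cyclic: "\<And>u v w. T u v w = T v w u"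
  obtains mult where "symplectic_alternating_algebra scale form mult"
    "\<And>u v w. form (mult u v) w = T u v w"
proof -
  \<comment> \<open>The representing vector in coordinates; the minus sign comes from (y_i, x_i) =
    -1.\<close>
  define mult where "mult u v =
    (\<Sum>i\<in>{1..n}. scale (T u v (y i)) (x i)) - (\<Sum>i\<in>{1..n}. scale (T u v (x i)) (y i))" for u v
  have T_0: "T u v 0 = 0" for u v using T_scale[of u v 0 0] by simp
  have T_sum: "T u v (\<Sum>i\<in>S. f i) = (\<Sum>i\<in>S. T u v (f i))" for u v f and S :: "nat set"
    by (induction S rule: infinite_finite_induct) (simp_all add: T_0 T_add)
  have form_mult: "form (mult u v) w = T u v w" for u v w
  proof -
    have "form (mult u v) w = (\<Sum>i\<in>{1..n}. T u v (y i) * form (x i) w)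
        + (\<Sum>i\<in>{1..n}. T u v (x i) * form w (y i))"
      by (simp add: mult_def form_simps form_swap[of "y _" w] sum_negf)
    also have "\<dots> = T u v ((\<Sum>i\<in>{1..n}. scale (form w (y i)) (x i))
        + (\<Sum>i\<in>{1..n}. scale (form (x i) w) (y i)))"
      by (simp add: T_add T_sum T_scale mult.commute add.commute)
    also have "\<dots> = T u v w" using standard_basis_expansion[OF B, of w] by simp
    finally show ?thesis .
  qed
  \<comment> \<open>Cyclicity rotates the first or second argument into the third, where linearity
    is assumed.\<close>
  have T_left: "T (u + u') v w = T u v w + T u' v w" "T (scale c u) v w = c * T u v w"
    and T_middle: "T v (u + u') w = T v u w + T v u' w" "T v (scale c u) w = c * T v u w"
    for c u u' v w
    using T_cyclic T_add T_scale by metis+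
  note cancel = form_left_cancel[OF span_UNIV]
  have "symplectic_alternating_algebra scale form mult"
  proof (intro symplectic_alternating_algebra.intro symplectic_space_axioms
      symplectic_alternating_algebra_axioms.intro)
    show "Vector_Spaces.linear scale scale (\<lambda>u. mult u v)" for v
      unfolding Vector_Spaces.linear_iff
      by (auto intro!: vector_space_axioms cancel simp: form_mult form_simps T_left)
    show "Vector_Spaces.linear scale scale (\<lambda>v. mult u v)" for u
      unfolding Vector_Spaces.linear_iff
      by (auto intro!: vector_space_axioms cancel simp: form_mult form_simps T_middle)
    show "mult u u = 0" for u
      by (rule cancel) (simp add: form_mult T_alternating form_zero_left)
    show "form (mult u v) w = form (mult v w) u" for u v w
      by (simp add: form_mult T_cyclic[of u v w])
  qed
  then show ?thesis using that form_mult by blast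
qed

end

section \<open>Symmetries of the ternary form and central elements modulo a subspace\<close>

context symplectic_alternating_algebra
begin

lemma mult_add_left: "(u + u') \<cdot> v = u \<cdot> v + u' \<cdot> v"
  using mult_linear_left[of v] by (simp add: Vector_Spaces.linear_iff)

lemma mult_scale_left: "scale c u \<cdot> v = scale c (u \<cdot> v)"
  using mult_linear_left[of v] by (simp add: Vector_Spaces.linear_iff)

lemma mult_zero_left: "0 \<cdot> v = 0"
  using mult_scale_left[of 0 0 v] by simp

lemma mult_add_right: "u \<cdot> (v + v') = u \<cdot> v + u \<cdot> v'"
  using mult_linear_right[of u] by (simp add: Vector_Spaces.linear_iff)

lemma mult_swap: "v \<cdot> u = - (u \<cdot> v)"
proof -
  have "(u + v) \<cdot> (u + v) = v \<cdot> u + u \<cdot> v"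
    by (subst mult_add_left) (simp add: mult_add_right mult_alternating add.commute)
  then have "v \<cdot> u + u \<cdot> v = 0" by (simp only: mult_alternating)
  then show ?thesis by (simp add: eq_neg_iff_add_eq_0)
qed

lemma form_mult_swap: "form (v \<cdot> u) w = - form (u \<cdot> v) w"
  using mult_swap[of v u] form_scale_left[of "- 1" "u \<cdot> v" w] by simp

lemma form_mult_swap_right: "form (u \<cdot> w) v = - form (u \<cdot> v) w"
  using form_mult_cyclic form_mult_swap by metis

lemma form_mult_repeated: "form (u \<cdot> u) w = 0" "form (u \<cdot> w) u = 0" "form (w \<cdot> u) u = 0"
proof -
  show *: "form (u \<cdot> u) w = 0" by (simp add: mult_alternating form_zero_left)
  show "form (u \<cdot> w) u = 0" using form_mult_swap_right[of u w u] * by simp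
  show "form (w \<cdot> u) u = 0" using form_mult_cyclic[of w u u] * by simp
qed

lemma mult_span_closed:
  assumes "v \<in> span A" "\<And>b. b \<in> A \<Longrightarrow> b \<cdot> u \<in> W" "subspace W"
  shows "v \<cdot> u \<in> W"
  using assms(1)
proof (induction rule: span_induct_alt)
  case base
  show ?case by (simp add: mult_zero_left subspace_0[OF assms(3)])
next
  case (step c b v)
  then show ?case
    unfolding mult_add_left mult_scale_left
    by (rule subspace_add[OF assms(3) subspace_scale[OF assms(3) assms(2)]])
qed

text \<open>Take the first term \<open>I s\<close> of the central chain whose intersection with
  \<open>W\<close> leaves \<open>J\<close>, and \<open>v\<close> in that intersection but outside
  \<open>J\<close>. Then every \<open>v \<cdot> u\<close> lies in \<open>W\<close> and in
  \<open>I (s - 1)\<close>, hence in \<open>J\<close>.\<close>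

lemma central_element_modulo:
  assumes nilpotent "subspace J" "\<not> W \<subseteq> J" "\<And>v u. v \<in> W \<Longrightarrow> v \<cdot> u \<in> W"
  obtains v where "v \<in> W" "v \<notin> J" "\<And>u. v \<cdot> u \<in> J"
proof -
  obtain m :: nat and I where chain: "I 0 = {0} \<and> I m = UNIV \<and> (\<forall>s\<le>m. ideal (I s)) \<and>
      (\<forall>s\<in>{1..m}. I (s - 1) \<subseteq> I s \<and> subspace_prod (I s) UNIV \<subseteq> I (s - 1))"
    using assms(1) unfolding nilpotent_def by (elim exE)
  then have I: "I 0 = {0}" "I m = UNIV" by simp_all
  have lower: "subspace_prod (I s) UNIV \<subseteq> I (s - 1)" if "s \<in> {1..m}" for s
    using chain that by simp
  define s where "s = (LEAST s. s \<le> m \<and> \<not> I s \<inter> W \<subseteq> J)"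
  have ex: "m \<le> m \<and> \<not> I m \<inter> W \<subseteq> J" using I(2) assms(3) by simp
  have s: "s \<le> m" "\<not> I s \<inter> W \<subseteq> J"
    using LeastI[of "\<lambda>s. s \<le> m \<and> \<not> I s \<inter> W \<subseteq> J", OF ex] by (auto simp: s_def)
  have "s \<noteq> 0"
  proof
    assume "s = 0"
    then show False using s(2) I(1) subspace_0[OF assms(2)] by auto
  qed
  then have prev: "I (s - 1) \<inter> W \<subseteq> J"
    using not_less_Least[of "s - 1" "\<lambda>s. s \<le> m \<and> \<not> I s \<inter> W \<subseteq> J"] s(1) by (auto simp: s_def)
  obtain v where v: "v \<in> I s" "v \<in> W" "v \<notin> J" using s(2) by blast
  have "v \<cdot> u \<in> J" for u
  proof -
    have "v \<cdot> u \<in> subspace_prod (I s) UNIV"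
      unfolding subspace_prod_def using v(1) by (intro span_base) blast
    then have "v \<cdot> u \<in> I (s - 1)" using lower[of s] s(1) \<open>s \<noteq> 0\<close> by auto
    then show ?thesis using prev assms(4)[OF v(2)] by blast
  qed
  then show ?thesis using that v by blast
qed

end

lemma (in vector_space) independent_if_triangular:
  assumes "\<And>i. i \<in> {1..k} \<Longrightarrow> z i \<notin> span (z ` {1..<i})"
  shows "inj_on z {1..k} \<and> independent (z ` {1..k :: nat})"
  using assms
proof (induction k)
  case (Suc k)
  have *: "{1..Suc k} = insert (Suc k) {1..k}" "{1..<Suc k} = {1..k}" by auto
  have "z (Suc k) \<notin> span (z ` {1..k})" using Suc.prems[of "Suc k"] * by simp
  moreover have "inj_on z {1..k} \<and> independent (z ` {1..k})" using Suc by simp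
  ultimately show ?case
    unfolding * using span_superset[of "z ` {1..k}"] by (auto simp: independent_insert)
qed (simp add: independent_empty)

section \<open>From nilpotency to a presentation\<close>

context symplectic_alternating_algebra
begin

text \<open>Each condition on \<open>z i\<close> refers only to the span of the earlier vectors, so
  appending a vector leaves the old conditions intact. The new vector is orthogonal to the old ones
  because it is chosen in \<open>J\<close>\<bottom>, and to itself because the form is
  alternating.\<close>

lemma isotropic_central_series:
  assumes nilpotent "dim (UNIV :: 'v set) = 2 * n" "k \<le> n"
  shows "\<exists>z. \<forall>i\<in>{1..k}. z i \<notin> span (z ` {1..<i}) \<and> (\<forall>u. z i \<cdot> u \<in> span (z ` {1..<i})) \<and>
    (\<forall>j\<in>{1..k}. form (z i) (z j) = 0)"
  using assms(3)
proof (induction k)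
  case (Suc k)
  then obtain z where z: "\<And>i. i \<in> {1..k} \<Longrightarrow> z i \<notin> span (z ` {1..<i})"
      "\<And>i u. i \<in> {1..k} \<Longrightarrow> z i \<cdot> u \<in> span (z ` {1..<i})"
      "\<And>i j. i \<in> {1..k} \<Longrightarrow> j \<in> {1..k} \<Longrightarrow> form (z i) (z j) = 0"
    by (metis Suc_leD)
  define J where "J = span (z ` {1..k})"
  define W where "W = {v. \<forall>s\<in>z ` {1..k}. form s v = 0}"
  have zJ: "z i \<cdot> u \<in> J" if "i \<in> {1..k}" for i u
  proof -
    have "span (z ` {1..<i}) \<subseteq> J"
      unfolding J_def using that by (intro span_mono image_mono) auto
    then show ?thesis using z(2)[OF that] by blast
  qed
  \<comment> \<open>Otherwise the whole space would have dimension at most 2k, while it has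
    dimension 2n > 2k.\<close>
  have "\<not> W \<subseteq> J"
  proof
    assume "W \<subseteq> J"
    then have "dim (UNIV :: 'v set) \<le> 2 * card {1..k}"
      using independent_if_triangular[of k z] z(1)
      by (intro dim_le_if_perp_subset[of _ z]) (auto simp: J_def W_def)
    then show False using assms(2) Suc.prems by simp
  qed
  moreover have "v \<cdot> u \<in> W" if "v \<in> W" for u v
  proof -
    have "form s (v \<cdot> u) = 0" if "s \<in> z ` {1..k}" for s
    proof -
      \<comment> \<open>\<open>J\<close>\<bottom> inherits closure under products from
        \<open>J\<close>: (vu, s) = (us, v) = -(su, v), and su lies in \<open>J\<close>.\<close>
      have "form (s \<cdot> u) v = 0"
      proof (rule form_0_span_left)
        show "s \<cdot> u \<in> span (z ` {1..k})" using zJ that by (auto simp: J_def)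
      qed (use \<open>v \<in> W\<close> in \<open>auto simp: W_def\<close>)
      then have "form (v \<cdot> u) s = 0"
        using form_mult_cyclic[of v u s] form_mult_swap[of u s v] by simp
      then show ?thesis by (simp add: form_eq_0_swap)
    qed
    then show ?thesis by (simp add: W_def)
  qed
  ultimately obtain v where v: "v \<in> W" "v \<notin> J" "\<And>u. v \<cdot> u \<in> J"
    using central_element_modulo[OF assms(1), of J W] by (auto simp: J_def)
  define z' where "z' = z(Suc k := v)"
  have old: "z' i = z i" "z' ` {1..<i} = z ` {1..<i}" if "i \<in> {1..k}" for i
    using that by (auto simp: z'_def)
  have new: "z' (Suc k) = v" "z' ` {1..<Suc k} = z ` {1..k}"
    by (auto simp: z'_def)
  have split: "i \<in> {1..k} \<or> i = Suc k" if "i \<in> {1..Suc k}" for i using that by auto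
  have vz: "form (z i) v = 0" "form v (z i) = 0" if "i \<in> {1..k}" for i
    using v(1) that by (auto simp: W_def form_eq_0_swap)
  have "z' i \<notin> span (z' ` {1..<i}) \<and> (\<forall>u. z' i \<cdot> u \<in> span (z' ` {1..<i})) \<and>
    (\<forall>j\<in>{1..Suc k}. form (z' i) (z' j) = 0)" if "i \<in> {1..Suc k}" for i
  proof -
    have "form (z' i) (z' j) = 0" if "j \<in> {1..Suc k}" for j
      using split[OF that] split[OF \<open>i \<in> {1..Suc k}\<close>] z(3) vz
      by (auto simp: old(1) new(1) form_alternating simp del: atLeastAtMost_iff)
    moreover have "z' i \<notin> span (z' ` {1..<i}) \<and> (\<forall>u. z' i \<cdot> u \<in> span (z' ` {1..<i}))"
      using split[OF that]
    proof
      assume "i \<in> {1..k}"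
      then show ?thesis using z old by simp
    next
      assume "i = Suc k"
      then show ?thesis using v(2,3) new by (simp add: J_def)
    qed
    ultimately show ?thesis by blast
  qed
  then show ?case by blast
qed simp

text \<open>The scalars are simply read off, so the content is the vanishing condition. Products
  with some \<open>x i\<close> stay in the isotropic span of the later \<open>x\<close>, which
  excludes two \<open>x\<close> in a nonzero triple and bounds the indices of the \<open>y\<close>
  from below.\<close>

lemma nilpotent_presentationI:
  assumes B: "standard_basis n x y"
    and flag: "\<And>i u. i \<in> {1..n} \<Longrightarrow> x i \<cdot> u \<in> span (x ` {i<..n})"
  shows "nilpotent_presentation n x y (\<lambda>i j k. form (x i \<cdot> y j) (y k)) (\<lambda>i j k. form (y i \<cdot> y j) (y k))"
proof -
  \<comment> \<open>\<open>P\<close> is a predicate on unordered sets, so a conclusion for one order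
    of a triple transfers to every other order.\<close>
  define P where "P A \<longleftrightarrow> (\<exists>i j k. 1 \<le> i \<and> i < j \<and> j < k \<and> k \<le> n \<and>
    (A = {x i, y j, y k} \<or> A = {y i, y j, y k}))" for A
  have xx: "form (x i \<cdot> u) (x j) = 0" if "i \<in> {1..n}" "j \<in> {1..n}" for i j u
  proof (rule form_0_span_left[OF flag[OF that(1)]])
    fix s assume "s \<in> x ` {i<..n}"
    then obtain l where "l \<in> {i<..n}" "s = x l" by blast
    then have "l \<in> {1..n}" by simp
    then show "form s (x j) = 0" using standard_basis_form(1)[OF B _ that(2)] \<open>s = x l\<close> by simp
  qed
  have less: "i < k" if "i \<in> {1..n}" "k \<in> {1..n}" "form (x i \<cdot> u) (y k) \<noteq> 0" for i k u
  proof (rule ccontr)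
    assume "\<not> i < k"
    have "form (x i \<cdot> u) (y k) = 0"
    proof (rule form_0_span_left[OF flag[OF that(1)]])
      fix s assume "s \<in> x ` {i<..n}"
      then obtain l where "l \<in> {i<..n}" "s = x l" by blast
      then have "l \<in> {1..n}" "l \<noteq> k" using \<open>\<not> i < k\<close> by auto
      then show "form s (y k) = 0" using standard_basis_form(3)[OF B _ that(2)] \<open>s = x l\<close> by simp
    qed
    then show False using that(3) by simp
  qed
  have xyy: "P {x i, y j, y k}"
    if "i \<in> {1..n}" "j \<in> {1..n}" "k \<in> {1..n}" "form (x i \<cdot> y j) (y k) \<noteq> 0" for i j k
  proof -
    \<comment> \<open>\<open>less\<close> bounds only the index in the last argument; exchanging the
      two \<open>y\<close> gives i < j as well.\<close>
    have "form (x i \<cdot> y k) (y j) \<noteq> 0"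
      using form_mult_swap_right[of "x i" "y k" "y j"] that(4) by simp
    then have "i < j" "i < k" "j \<noteq> k" using less that form_mult_repeated by auto
    then show ?thesis
      using that by (cases j k rule: linorder_cases) (auto simp: P_def insert_commute)
  qed
  have yyy: "P {y i, y j, y k}"
    if "i \<in> {1..n}" "j \<in> {1..n}" "k \<in> {1..n}" "form (y i \<cdot> y j) (y k) \<noteq> 0" for i j k
  proof -
    have "i \<noteq> j" "j \<noteq> k" "i \<noteq> k" using that(4) form_mult_repeated by auto
    then consider "i < j" "j < k" | "i < k" "k < j" | "j < i" "i < k" | "j < k" "k < i"
      | "k < i" "i < j" | "k < j" "j < i" by linarith
    then show ?thesis
      using that(1-3) unfolding P_def by cases (fastforce simp: insert_commute)+
  qed
  \<comment> \<open>At most one of the three is an \<open>x\<close>, and a cyclic rotation moves it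
    to the front, where \<open>xyy\<close> applies.\<close>
  have "P {a, b, c}"
    if abc: "a \<in> x ` {1..n} \<union> y ` {1..n}" "b \<in> x ` {1..n} \<union> y ` {1..n}" "c \<in> x ` {1..n} \<union> y ` {1..n}"
      and nz: "form (a \<cdot> b) c \<noteq> 0" for a b c
  proof -
    have nz': "form (b \<cdot> c) a \<noteq> 0" "form (c \<cdot> a) b \<noteq> 0"
      using nz form_mult_cyclic by metis+
    from abc(1) show ?thesis
    proof
      assume "a \<in> x ` {1..n}"
      then obtain i where i: "i \<in> {1..n}" "a = x i" by blast
      have "b \<notin> x ` {1..n}" using nz'(1) xx[OF _ i(1), of _ c] i(2) by blast
      moreover have "c \<notin> x ` {1..n}" using nz xx[OF i(1), of _ b] i(2) by blast
      ultimately obtain j k where "j \<in> {1..n}" "b = y j" "k \<in> {1..n}" "c = y k" using abc(2,3) by blast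
      then show ?thesis using xyy i nz by blast
    next
      assume "a \<in> y ` {1..n}"
      then obtain i where i: "i \<in> {1..n}" "a = y i" by blast
      from abc(2) show ?thesis
      proof
        assume "b \<in> x ` {1..n}"
        then obtain j where j: "j \<in> {1..n}" "b = x j" by blast
        have "c \<notin> x ` {1..n}" using nz'(2) xx[OF _ j(1), of _ a] j(2) by blast
        then obtain k where "k \<in> {1..n}" "c = y k" using abc(3) by blast
        then have "P {b, c, a}" using xyy[of j k i] i j nz'(1) by blast
        then show ?thesis by (simp add: insert_commute)
      next
        assume "b \<in> y ` {1..n}"
        then obtain j where j: "j \<in> {1..n}" "b = y j" by blast
        from abc(3) show ?thesis
        proof
          assume "c \<in> x ` {1..n}"
          then have "P {c, a, b}" using xyy[of _ i j] i j nz'(2) by blast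
          then show ?thesis by (simp add: insert_commute)
        next
          assume "c \<in> y ` {1..n}"
          then show ?thesis using yyy[of i j] i j nz by blast
        qed
      qed
    qed
  qed
  then have vanish: "form (a \<cdot> b) c = 0"
    if "a \<in> x ` {1..n} \<union> y ` {1..n}" "b \<in> x ` {1..n} \<union> y ` {1..n}" "c \<in> x ` {1..n} \<union> y ` {1..n}"
      and "\<not> P {a, b, c}" for a b c
    using that by blast
  show ?thesis
    unfolding nilpotent_presentation_def using B vanish unfolding P_def by simp
qed

lemma nilpotent_imp_presentation:
  assumes nilpotent "dim (UNIV :: 'v set) = 2 * n"
  shows "\<exists>x y \<alpha> \<beta>. nilpotent_presentation n x y \<alpha> \<beta>"
proof -
  obtain z where z: "\<And>i. i \<in> {1..n} \<Longrightarrow> z i \<notin> span (z ` {1..<i})"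
      "\<And>i u. i \<in> {1..n} \<Longrightarrow> z i \<cdot> u \<in> span (z ` {1..<i})"
      "\<And>i j. i \<in> {1..n} \<Longrightarrow> j \<in> {1..n} \<Longrightarrow> form (z i) (z j) = 0"
    using isotropic_central_series[OF assms order_refl] by blast
  \<comment> \<open>The order is reversed: the central vector \<open>z 1\<close> becomes
    \<open>x n\<close>, and the span of the vectors before \<open>z i\<close> becomes the span of
    the \<open>x\<close> with larger index.\<close>
  define x where "x i = z (Suc n - i)" for i
  have image: "x ` S = z ` ((\<lambda>i. Suc n - i) ` S)" for S by (simp add: x_def image_image)
  have flip: "(\<lambda>i. Suc n - i) ` {i<..n} = {1..<Suc n - i}" if "i \<le> n" for i
  proof (intro equalityI subsetI)
    fix j assume "j \<in> {1..<Suc n - i}"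
    then show "j \<in> (\<lambda>i. Suc n - i) ` {i<..n}" by (intro image_eqI[of _ _ "Suc n - j"]) auto
  qed auto
  have flip_all: "(\<lambda>i. Suc n - i) ` {1..n} = {1..n}"
    using flip[of 0] by (simp add: atLeastLessThanSuc_atLeastAtMost atLeastSucAtMost_greaterThanAtMost)
  have range: "Suc n - i \<in> {1..n}" if "i \<in> {1..n}" for i using that by auto
  have zi: "inj_on z {1..n}" "independent (z ` {1..n})"
    using independent_if_triangular[of n z] z(1) by auto
  have "inj_on x {1..n}"
    using inj_onD[OF zi(1)] range by (fastforce simp: x_def inj_on_def)
  moreover have "independent (x ` {1..n})" using zi(2) by (simp only: image flip_all not_False_eq_True)
  moreover have "form (x i) (x j) = 0" if "i \<in> {1..n}" "j \<in> {1..n}" for i j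
    using z(3) that range by (simp add: x_def)
  ultimately obtain y where "standard_basis n x y"
    using standard_basis_extension[OF assms(2)] by blast
  moreover have "x i \<cdot> u \<in> span (x ` {i<..n})" if "i \<in> {1..n}" for i u
    using z(2)[OF range[OF that]] that flip[of i] by (simp only: image x_def) simp
  ultimately show ?thesis using nilpotent_presentationI by blast
qed

section \<open>From a presentation to nilpotency\<close>

lemma presentation_mult_eq_0:
  assumes P: "nilpotent_presentation n x y \<alpha> \<beta>" and i: "i \<in> {1..n}" and k: "k \<in> {1..n}"
  shows "x i \<cdot> x k = 0" and "k \<le> i \<Longrightarrow> x i \<cdot> y k = 0"
proof -
  let ?B = "x ` {1..n} \<union> y ` {1..n}"
  have B: "standard_basis n x y" using P by (simp add: nilpotent_presentation_def)
  have vanish: "form (a \<cdot> b) c = 0" if "a \<in> ?B" "b \<in> ?B" "c \<in> ?B"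
    "\<nexists>i j k. 1 \<le> i \<and> i < j \<and> j < k \<and> k \<le> n \<and>
           ({a, b, c} = {x i, y j, y k} \<or> {a, b, c} = {y i, y j, y k})" for a b c
    using P that unfolding nilpotent_presentation_def by blast
  have cancel: "u = 0" if "\<And>c. c \<in> ?B \<Longrightarrow> form u c = 0" for u
    using form_left_cancel[of ?B u 0] B that by (simp add: standard_basis_def form_zero_left)
  \<comment> \<open>The next facts turn equality of sets of basis vectors into equality of indices.
    An admissible triple contains at most one \<open>x\<close>, and its index is smaller than those
    of both \<open>y\<close>; hence all pairings of the two products with the basis vanish.\<close>
  have x_in: "l = l'" if "l \<in> {1..n}" "l' \<in> {1..n}" "j \<in> {1..n}" "j' \<in> {1..n}"
    "x l \<in> {x l', y j, y j'}" for l l' j j'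
    using that standard_basis_distinct[OF B] by auto
  have x_notin: "x l \<notin> {y l', y j, y j'}"
    if "l \<in> {1..n}" "l' \<in> {1..n}" "j \<in> {1..n}" "j' \<in> {1..n}" for l l' j j'
    using that standard_basis_distinct[OF B] by auto
  have y_in: "k \<in> {j, j'}" if "l' \<in> {1..n}" "j \<in> {1..n}" "j' \<in> {1..n}"
    "y k \<in> {x l', y j, y j'}" for l' j j'
    using that k standard_basis_distinct[OF B] by auto
  show "x i \<cdot> x k = 0"
  proof (cases "i = k")
    case False
    show ?thesis
    proof (rule cancel, rule vanish)
      fix c
      show "\<nexists>i' j' k'. 1 \<le> i' \<and> i' < j' \<and> j' < k' \<and> k' \<le> n \<and>
         ({x i, x k, c} = {x i', y j', y k'} \<or> {x i, x k, c} = {y i', y j', y k'})"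
      proof (rule notI, elim exE conjE)
        fix i' j' k'
        assume "1 \<le> i'" "i' < j'" "j' < k'" "k' \<le> n"
        then have r: "i' \<in> {1..n}" "j' \<in> {1..n}" "k' \<in> {1..n}" by auto
        assume "{x i, x k, c} = {x i', y j', y k'} \<or> {x i, x k, c} = {y i', y j', y k'}"
        then show False
        proof
          assume "{x i, x k, c} = {x i', y j', y k'}"
          then have "x i \<in> {x i', y j', y k'}" "x k \<in> {x i', y j', y k'}" by blast+
          then show False using x_in[OF i r] x_in[OF k r] False by simp
        next
          assume "{x i, x k, c} = {y i', y j', y k'}"
          then have "x i \<in> {y i', y j', y k'}" by blast
          then show False using x_notin[OF i r] by simp
        qed
      qed
    qed (use i k in auto)
  qed (simp add: mult_alternating)
  show "x i \<cdot> y k = 0" if "k \<le> i"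
  proof (rule cancel, rule vanish)
    fix c
    show "\<nexists>i' j' k'. 1 \<le> i' \<and> i' < j' \<and> j' < k' \<and> k' \<le> n \<and>
       ({x i, y k, c} = {x i', y j', y k'} \<or> {x i, y k, c} = {y i', y j', y k'})"
    proof (rule notI, elim exE conjE)
      fix i' j' k'
      assume less: "1 \<le> i'" "i' < j'" "j' < k'" "k' \<le> n"
      then have r: "i' \<in> {1..n}" "j' \<in> {1..n}" "k' \<in> {1..n}" by auto
      assume "{x i, y k, c} = {x i', y j', y k'} \<or> {x i, y k, c} = {y i', y j', y k'}"
      then show False
      proof
        assume "{x i, y k, c} = {x i', y j', y k'}"
        then have "x i \<in> {x i', y j', y k'}" "y k \<in> {x i', y j', y k'}" by blast+
        then show False using x_in[OF i r] y_in[OF r] less that by auto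
      next
        assume "{x i, y k, c} = {y i', y j', y k'}"
        then have "x i \<in> {y i', y j', y k'}" by blast
        then show False using x_notin[OF i r] by simp
      qed
    qed
  qed (use i k in auto)
qed

lemma presentation_imp_nilpotent:
  assumes P: "nilpotent_presentation n x y \<alpha> \<beta>"
  shows nilpotent
proof -
  have B: "standard_basis n x y" using P by (simp add: nilpotent_presentation_def)
  \<comment> \<open>The first \<open>s\<close> vectors of x_n, ..., x_1, y_1, ..., y_n. Writing the
    bounds additively avoids truncated subtraction and treats s \<le> n and s > n uniformly.\<close>
  define A where "A s = x ` {i \<in> {1..n}. n < s + i} \<union> y ` {i \<in> {1..n}. n + i \<le> s}" for s
  \<comment> \<open>Membership is tested by the coefficients at the basis vectors outside
    \<open>A s\<close>.\<close>
  have in_span: "w \<in> span (A s)"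
    if "\<And>k. k \<in> {1..n} \<Longrightarrow> s + k \<le> n \<Longrightarrow> form w (y k) = 0"
      "\<And>k. k \<in> {1..n} \<Longrightarrow> s < n + k \<Longrightarrow> form (x k) w = 0" for w s
  proof -
    have "scale (form w (y k)) (x k) \<in> span (A s)" if k: "k \<in> {1..n}" for k
    proof (cases "s + k \<le> n")
      case True
      then show ?thesis using \<open>\<And>k. k \<in> {1..n} \<Longrightarrow> s + k \<le> n \<Longrightarrow> form w (y k) = 0\<close>[OF k] span_zero by simp
    next
      case False
      then show ?thesis using k by (intro span_scale span_base) (auto simp: A_def)
    qed
    moreover have "scale (form (x k) w) (y k) \<in> span (A s)" if k: "k \<in> {1..n}" for k
    proof (cases "s < n + k")
      case True
      then show ?thesis using \<open>\<And>k. k \<in> {1..n} \<Longrightarrow> s < n + k \<Longrightarrow> form (x k) w = 0\<close>[OF k] span_zero by simp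
    next
      case False
      then show ?thesis using k by (intro span_scale span_base) (auto simp: A_def)
    qed
    ultimately show ?thesis
      by (subst standard_basis_expansion[OF B, of w]) (intro span_add span_sum)
  qed
  \<comment> \<open>Moving \<open>u\<close> to the last argument reduces the coefficients of
    \<open>a \<cdot> u\<close>, for arbitrary \<open>u\<close>, to products of two basis
    vectors.\<close>
  have x_coeff: "form (a \<cdot> u) (y k) = 0" if "a \<cdot> y k = 0" for a u k
    using that form_mult_swap_right[of a u "y k"] by (simp add: form_zero_left)
  have y_coeff: "form (x k) (a \<cdot> u) = 0" if "x k \<cdot> a = 0" for a u k
  proof -
    have "form (a \<cdot> u) (x k) = form (x k \<cdot> a) u"
      using form_mult_cyclic by metis
    then show ?thesis using that by (simp add: form_zero_left form_eq_0_swap)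
  qed
  have step: "b \<cdot> u \<in> span (A s)" if b: "b \<in> A (Suc s)" for b u s
  proof -
    from b consider i where "i \<in> {1..n}" "n < Suc s + i" "b = x i"
      | i where "i \<in> {1..n}" "n + i \<le> Suc s" "b = y i"
      unfolding A_def by blast
    then show ?thesis
    proof cases
      case i: 1
      show ?thesis
      proof (rule in_span)
        fix k assume "k \<in> {1..n}"
        show "form (b \<cdot> u) (y k) = 0" if "s + k \<le> n"
          \<comment> \<open>Here k \<le> n - s \<le> i.\<close>
          using presentation_mult_eq_0(2)[OF P i(1) \<open>k \<in> {1..n}\<close>] i that by (simp add: x_coeff)
        show "form (x k) (b \<cdot> u) = 0"
          using presentation_mult_eq_0(1)[OF P \<open>k \<in> {1..n}\<close> i(1)] i by (simp add: y_coeff)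
      qed
    next
      case i: 2
      show ?thesis
      proof (rule in_span)
        fix k assume "k \<in> {1..n}"
        show "form (b \<cdot> u) (y k) = 0" if "s + k \<le> n"
          \<comment> \<open>A vector \<open>y i\<close> occurs in \<open>A (Suc s)\<close> only when
            s \<ge> n, so no \<open>k\<close> satisfies s + k \<le> n. In the other condition, n + i
            \<le> s + 1 \<le> n + k gives i \<le> k.\<close>
          using i that \<open>k \<in> {1..n}\<close> by auto
        show "form (x k) (b \<cdot> u) = 0" if "s < n + k"
          using presentation_mult_eq_0(2)[OF P \<open>k \<in> {1..n}\<close> i(1)] i that by (simp add: y_coeff)
      qed
    qed
  qed
  have prod_step: "subspace_prod (span (A (Suc s))) UNIV \<subseteq> span (A s)" for s
    unfolding subspace_prod_def
  proof (rule span_minimal)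
    show "{u \<cdot> v |u v. u \<in> span (A (Suc s)) \<and> v \<in> UNIV} \<subseteq> span (A s)"
      using mult_span_closed step subspace_span by blast
  qed simp
  have mono: "span (A s) \<subseteq> span (A (Suc s))" for s
    by (rule span_mono) (auto simp: A_def)
  have A_0: "A 0 = {}" by (auto simp: A_def)
  have A_top: "A (2 * n) = x ` {1..n} \<union> y ` {1..n}" by (auto simp: A_def)
  have "ideal (span (A s))" for s
  proof (cases s)
    case 0
    have "subspace_prod (span (A 0)) UNIV \<subseteq> span (A 0)"
      unfolding subspace_prod_def by (rule span_minimal) (auto simp: A_0 mult_zero_left)
    then show ?thesis using 0 by (simp add: ideal_def)
  next
    case (Suc r)
    then show ?thesis using prod_step[of r] mono[of r] by (auto simp: ideal_def)
  qed
  moreover have "span (A (s - 1)) \<subseteq> span (A s) \<and> subspace_prod (span (A s)) UNIV \<subseteq> span (A (s - 1))"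
    if "s \<in> {1..2 * n}" for s
    using that prod_step[of "s - 1"] mono[of "s - 1"] by simp
  moreover have "span (A (2 * n)) = UNIV" "span (A 0) = {0}"
    using B by (simp_all add: A_top A_0 standard_basis_def)
  ultimately show ?thesis
    unfolding nilpotent_def by (intro exI[of _ "2 * n"] exI[of _ "\<lambda>s. span (A s)"]) blast
qed

end

section \<open>Uniqueness and existence of the algebra with a given presentation\<close>

context symplectic_space
begin

lemma mult_unique:
  assumes "symplectic_alternating_algebra scale form m" "symplectic_alternating_algebra scale form m'"
    and P: "symplectic_alternating_algebra.nilpotent_presentation scale form m n x y \<alpha> \<beta>"
    and P': "symplectic_alternating_algebra.nilpotent_presentation scale form m' n x y \<alpha> \<beta>"
  shows "m = m'"
proof -
  interpret M: symplectic_alternating_algebra scale form m by fact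
  interpret M': symplectic_alternating_algebra scale form m' by fact
  let ?B = "x ` {1..n} \<union> y ` {1..n}"
  \<comment> \<open>Agreement on one order of a triple spreads to all orders by the signs common to
    both forms; with a repeated entry both values are zero.\<close>
  have perm: "form (m a b) c = form (m' a b) c"
    if S: "{a, b, c} = {p, q, r}" and eq: "form (m p q) r = form (m' p q) r" for a b c p q r
  proof (cases "a = b \<or> b = c \<or> a = c")
    case True
    then show ?thesis using M.form_mult_repeated M'.form_mult_repeated by auto
  next
    case False
    have M: "form (m q r) p = form (m p q) r" "form (m r p) q = form (m p q) r"
      "form (m q p) r = - form (m p q) r" "form (m p r) q = - form (m p q) r"
      "form (m r q) p = - form (m p q) r"
      using M.form_mult_cyclic M.form_mult_swap by metis+
    have M': "form (m' q r) p = form (m' p q) r" "form (m' r p) q = form (m' p q) r"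
      "form (m' q p) r = - form (m' p q) r" "form (m' p r) q = - form (m' p q) r"
      "form (m' r q) p = - form (m' p q) r"
      using M'.form_mult_cyclic M'.form_mult_swap by metis+
    have "a \<in> {p, q, r}" "b \<in> {p, q, r}" "c \<in> {p, q, r}" using S by blast+
    then show ?thesis using False M M' eq by auto
  qed
  have basis: "form (m a b) c = form (m' a b) c" if "a \<in> ?B" "b \<in> ?B" "c \<in> ?B" for a b c
  proof (cases "\<exists>i j k. 1 \<le> i \<and> i < j \<and> j < k \<and> k \<le> n \<and>
           ({a, b, c} = {x i, y j, y k} \<or> {a, b, c} = {y i, y j, y k})")
    case True
    then obtain i j k where ijk: "1 \<le> i \<and> i < j \<and> j < k \<and> k \<le> n"
      and S: "{a, b, c} = {x i, y j, y k} \<or> {a, b, c} = {y i, y j, y k}" by blast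
    have "form (m (x i) (y j)) (y k) = form (m' (x i) (y j)) (y k)"
      "form (m (y i) (y j)) (y k) = form (m' (y i) (y j)) (y k)"
      using P P' ijk unfolding M.nilpotent_presentation_def M'.nilpotent_presentation_def by simp_all
    then show ?thesis using S perm by blast
  next
    case False
    then have "form (m a b) c = 0" "form (m' a b) c = 0"
      using P P' that unfolding M.nilpotent_presentation_def M'.nilpotent_presentation_def by blast+
    then show ?thesis by simp
  qed
  have span: "span ?B = UNIV" using P by (simp add: M.nilpotent_presentation_def standard_basis_def)
  note cancel = form_left_cancel[OF span]
  \<comment> \<open>The restriction to basis vectors is lifted one argument at a time: equality of
    products frees the last argument, and a rotation makes the freed argument a factor of the next
    product.\<close>
  have 1: "m a b = m' a b" if "a \<in> ?B" "b \<in> ?B" for a b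
    by (rule cancel) (rule basis[OF that])
  have 2: "m a u = m' a u" if "a \<in> ?B" for a u
  proof (rule cancel)
    fix b assume "b \<in> ?B"
    then show "form (m a u) b = form (m' a u) b"
      using 1[OF _ that] M.form_mult_cyclic M'.form_mult_cyclic by metis
  qed
  have "m u v = m' u v" for u v
  proof (rule cancel)
    fix a assume "a \<in> ?B"
    then show "form (m u v) a = form (m' u v) a"
      using 2 M.form_mult_cyclic M'.form_mult_cyclic by metis
  qed
  then show ?thesis by blast
qed

end

text \<open>For linear functionals this is their exterior product f \<and> g \<and> h, written out
  as a 3 by 3 determinant; it vanishes on repeated arguments in every characteristic.\<close>

definition det3 :: "('v \<Rightarrow> 'a::comm_ring_1) \<Rightarrow> ('v \<Rightarrow> 'a) \<Rightarrow> ('v \<Rightarrow> 'a) \<Rightarrow> 'v \<Rightarrow> 'v \<Rightarrow> 'v \<Rightarrow> 'a" where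
  "det3 f g h u v w = f u * g v * h w + f v * g w * h u + f w * g u * h v
    - f v * g u * h w - f u * g w * h v - f w * g v * h u"

context symplectic_space
begin

lemma presentation_exists:
  assumes B: "standard_basis n x y"
  shows "\<exists>m. symplectic_alternating_algebra scale form m \<and>
    symplectic_alternating_algebra.nilpotent_presentation scale form m n x y \<alpha> \<beta>"
proof -
  define K where "K = {(i, j, k). 1 \<le> i \<and> i < j \<and> j < k \<and> k \<le> n}"
  \<comment> \<open>\<open>X i\<close> and \<open>Y i\<close> are the coordinate functionals of the
    standard basis. \<open>T\<close> below is the sum of the exterior products of these, weighted by
    the prescribed scalars.\<close>
  define X where "X i v = form v (y i)" for i v
  define Y where "Y i v = form (x i) v" for i v
  define t where "t = (\<lambda>(i, j, k) u v w. \<alpha> i j k * det3 (X i) (Y j) (Y k) u v w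
    + \<beta> i j k * det3 (Y i) (Y j) (Y k) u v w)"
  define T where "T u v w = (\<Sum>p\<in>K. t p u v w)" for u v w
  have "K \<subseteq> {1..n} \<times> {1..n} \<times> {1..n}" by (auto simp: K_def)
  then have "finite K" by (rule finite_subset) simp
  have XY_add: "X i (v + w) = X i v + X i w" "Y i (v + w) = Y i v + Y i w" for i v w
    by (simp_all add: X_def Y_def form_simps)
  have XY_scale: "X i (scale c v) = c * X i v" "Y i (scale c v) = c * Y i v" for i c v
    by (simp_all add: X_def Y_def form_simps)
  have t_add: "t p u v (w + w') = t p u v w + t p u v w'"
    and t_scale: "t p u v (scale c w) = c * t p u v w"
    and t_alternating: "t p u u w = 0" and t_cyclic: "t p u v w = t p v w u" for p u v w w' c
    by (cases p; simp add: t_def det3_def XY_add XY_scale algebra_simps)+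
  have "T u v (w + w') = T u v w + T u v w'" "T u v (scale c w) = c * T u v w"
    "T u u w = 0" "T u v w = T v w u" for u v w w' c
    by (simp_all add: T_def t_add t_scale t_alternating t_cyclic[of _ u v w] sum.distrib sum_distrib_left)
  then obtain m where alg: "symplectic_alternating_algebra scale form m"
    and form_m: "\<And>u v w. form (m u v) w = T u v w"
    using algebra_of_trilinear_form[OF B, of T] by blast
  interpret M: symplectic_alternating_algebra scale form m by (rule alg)
  have coord: "X i (x j) = (if i = j then 1 else 0)" "X i (y j) = 0"
    "Y i (y j) = (if i = j then 1 else 0)" "Y i (x j) = 0" if "i \<in> {1..n}" "j \<in> {1..n}" for i j
    using that standard_basis_form[OF B] by (auto simp: X_def Y_def)
  have basis_values: "T (x i) (y j) (y k) = \<alpha> i j k \<and> T (y i) (y j) (y k) = \<beta> i j k"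
    if "1 \<le> i \<and> i < j \<and> j < k \<and> k \<le> n" for i j k
  proof -
    have in_K: "(i, j, k) \<in> K" using that by (simp add: K_def)
    \<comment> \<open>A surviving determinant term must match the indices of \<open>p\<close> with
      i, j, k; as both are increasing, only the diagonal term of the summand p = (i, j, k)
      remains.\<close>
    have "t p (x i) (y j) (y k) = (if p = (i, j, k) then \<alpha> i j k else 0)"
      "t p (y i) (y j) (y k) = (if p = (i, j, k) then \<beta> i j k else 0)" if "p \<in> K" for p
      using that \<open>1 \<le> i \<and> i < j \<and> j < k \<and> k \<le> n\<close>
      by (auto simp: t_def K_def det3_def coord split: if_splits)
    then show ?thesis using in_K \<open>finite K\<close> by (simp add: T_def)
  qed
  have vanish: "T a b c = 0"
    if "a \<in> x ` {1..n} \<union> y ` {1..n}" "b \<in> x ` {1..n} \<union> y ` {1..n}" "c \<in> x ` {1..n} \<union> y ` {1..n}"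
      and N: "\<nexists>i j k. 1 \<le> i \<and> i < j \<and> j < k \<and> k \<le> n \<and>
           ({a, b, c} = {x i, y j, y k} \<or> {a, b, c} = {y i, y j, y k})" for a b c
    unfolding T_def
  proof (intro sum.neutral ballI)
    fix p assume "p \<in> K"
    then obtain i j k where p: "p = (i, j, k)" "1 \<le> i" "i < j" "j < k" "k \<le> n" by (auto simp: K_def)
    then have N': "{a, b, c} \<noteq> {x i, y j, y k}" "{a, b, c} \<noteq> {y i, y j, y k}" using N by blast+
    \<comment> \<open>A nonzero coordinate identifies a basis vector. So a nonzero determinant term
      would make {a, b, c} one of the admissible triples.\<close>
    have X_nz: "d = x l" if "l \<in> {1..n}" "d \<in> {a, b, c}" "X l d \<noteq> 0" for l d
      using that \<open>a \<in> _\<close> \<open>b \<in> _\<close> \<open>c \<in> _\<close> coord by (auto split: if_splits)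
    have Y_nz: "d = y l" if "l \<in> {1..n}" "d \<in> {a, b, c}" "Y l d \<noteq> 0" for l d
      using that \<open>a \<in> _\<close> \<open>b \<in> _\<close> \<open>c \<in> _\<close> coord by (auto split: if_splits)
    have r: "i \<in> {1..n}" "j \<in> {1..n}" "k \<in> {1..n}" using p by auto
    have 1: "X i d * Y j e * Y k f = 0" if "{d, e, f} = {a, b, c}" for d e f
    proof (rule ccontr)
      assume "X i d * Y j e * Y k f \<noteq> 0"
      then have "X i d \<noteq> 0" "Y j e \<noteq> 0" "Y k f \<noteq> 0" by auto
      moreover have "d \<in> {a, b, c}" "e \<in> {a, b, c}" "f \<in> {a, b, c}" using that by blast+
      ultimately have "d = x i" "e = y j" "f = y k" using X_nz Y_nz r by blast+
      then show False using N'(1) that by simp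
    qed
    have 2: "Y i d * Y j e * Y k f = 0" if "{d, e, f} = {a, b, c}" for d e f
    proof (rule ccontr)
      assume "Y i d * Y j e * Y k f \<noteq> 0"
      then have "Y i d \<noteq> 0" "Y j e \<noteq> 0" "Y k f \<noteq> 0" by auto
      moreover have "d \<in> {a, b, c}" "e \<in> {a, b, c}" "f \<in> {a, b, c}" using that by blast+
      ultimately have "d = y i" "e = y j" "f = y k" using Y_nz r by blast+
      then show False using N'(2) that by simp
    qed
    have "{b, c, a} = {a, b, c}" "{c, a, b} = {a, b, c}" "{b, a, c} = {a, b, c}"
      "{a, c, b} = {a, b, c}" "{c, b, a} = {a, b, c}" by auto
    note perms = refl this
    show "t p a b c = 0"
      unfolding p(1) t_def det3_def prod.case perms[THEN 1] perms[THEN 2] by simp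
  qed
  have "M.nilpotent_presentation n x y \<alpha> \<beta>"
    unfolding M.nilpotent_presentation_def form_m
  proof (intro conjI B)
    show "\<forall>i j k. 1 \<le> i \<and> i < j \<and> j < k \<and> k \<le> n \<longrightarrow>
        T (x i) (y j) (y k) = \<alpha> i j k \<and> T (y i) (y j) (y k) = \<beta> i j k"
      using basis_values by simp
  qed (intro ballI impI vanish)
  then show ?thesis using alg by blast
qed

end

text \<open>The phrase "the algebra described by the presentation" is justified by unique existence
  of the product on a given symplectic space with standard basis; nilpotency is then asserted of
  that product.\<close>

theorem mainTheorem2:
  fixes scale :: "'a::field \<Rightarrow> 'v::ab_group_add \<Rightarrow> 'v"
  shows
    "(\<forall>form mult n.
        symplectic_alternating_algebra scale form mult \<and>
        vector_space.dim scale (UNIV :: 'v set) = 2 * n \<and>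
        symplectic_alternating_algebra.nilpotent scale mult \<longrightarrow>
        (\<exists>x y \<alpha> \<beta>.
          symplectic_alternating_algebra.nilpotent_presentation scale form mult n x y \<alpha> \<beta>)) \<and>
     (\<forall>form n x y \<alpha> \<beta>.
        symplectic_space scale form \<and> symplectic_space.standard_basis scale form n x y \<longrightarrow>
        (\<exists>!mult. symplectic_alternating_algebra scale form mult \<and>
           symplectic_alternating_algebra.nilpotent_presentation scale form mult n x y \<alpha> \<beta>) \<and>
        (\<forall>mult. symplectic_alternating_algebra scale form mult \<and>
           symplectic_alternating_algebra.nilpotent_presentation scale form mult n x y \<alpha> \<beta> \<longrightarrow>
           symplectic_alternating_algebra.nilpotent scale mult))"
proof (intro conjI allI impI; (elim conjE)?)
  fix form mult and n :: nat
  assume "symplectic_alternating_algebra scale form mult"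
  then interpret symplectic_alternating_algebra scale form mult .
  assume "dim (UNIV :: 'v set) = 2 * n" nilpotent
  then show "\<exists>x y \<alpha> \<beta>. nilpotent_presentation n x y \<alpha> \<beta>"
    using nilpotent_imp_presentation by blast
next
  fix form n x y \<alpha> \<beta>
  assume S: "symplectic_space scale form"
    and B: "symplectic_space.standard_basis scale form n x y"
  show "\<exists>!mult. symplectic_alternating_algebra scale form mult \<and>
    symplectic_alternating_algebra.nilpotent_presentation scale form mult n x y \<alpha> \<beta>"
    using symplectic_space.presentation_exists[OF S B, of \<alpha> \<beta>] symplectic_space.mult_unique[OF S]
    by blast
next
  fix form mult n x y \<alpha> \<beta>
  assume "symplectic_alternating_algebra scale form mult"
    "symplectic_alternating_algebra.nilpotent_presentation scale form mult n x y \<alpha> \<beta>"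
  then show "symplectic_alternating_algebra.nilpotent scale mult"
    by (rule symplectic_alternating_algebra.presentation_imp_nilpotent)
qed

end
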